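(* Let $\varepsilon>0$ and let $D=D(d)$ satisfy $D=O(d^{1/2-\varepsilon})$. Let $U$ be a $d'$-dimensional normed space such that for every $d$-dimensional normed space $X$ there exists a distribution $\mathcal{D}$ supported on linear maps $f:\mathbb{R}^d\to\mathbb{R}^{d'}$ such that for every $x\in\mathbb{R}^d$, \[\|x\|_X\le\|f(x)\|_U\le D\|x\|_X\] holds with probability at least $2/3$ over $f\sim\mathcal{D}$. Then $d'=\exp(\Omega(d^{2\varepsilon}))$. *)

theory Defs
  imports "HOL-Probability.Probability" "HOL-Analysis.Abstract_Euclidean_Space"
    "HOL-Library.Landau_Symbols"
begin

abbreviation Rn :: "nat \<Rightarrow> (nat \<Rightarrow> real) set" where
  "Rn n \<equiv> topspace (Euclidean_space n)"

text \<open>Up to isometry, the \<open>n\<close>-dimensional normed spaces are \<open>\<real>\<^sup>n\<close> with a norm on it;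
  values of the norm outside \<open>Rn n\<close> are irrelevant.\<close>

definition norm_on :: "nat \<Rightarrow> ((nat \<Rightarrow> real) \<Rightarrow> real) \<Rightarrow> bool" where
  "norm_on n N \<longleftrightarrow>
     (\<forall>x\<in>Rn n. 0 \<le> N x) \<and>
     (\<forall>x\<in>Rn n. N x = 0 \<longleftrightarrow> x = (\<lambda>_. 0)) \<and>
     (\<forall>c. \<forall>x\<in>Rn n. N (\<lambda>i. c * x i) = \<bar>c\<bar> * N x) \<and>
     (\<forall>x\<in>Rn n. \<forall>y\<in>Rn n. N (\<lambda>i. x i + y i) \<le> N x + N y)"

definition lin_maps :: "nat \<Rightarrow> nat \<Rightarrow> ((nat \<Rightarrow> real) \<Rightarrow> (nat \<Rightarrow> real)) set" where
  "lin_maps m n =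
     {f \<in> Rn m \<rightarrow>\<^sub>E Rn n.
        (\<forall>x\<in>Rn m. \<forall>y\<in>Rn m. f (\<lambda>i. x i + y i) = (\<lambda>i. f x i + f y i)) \<and>
        (\<forall>c. \<forall>x\<in>Rn m. f (\<lambda>i. c * x i) = (\<lambda>i. c * f x i))}"

text \<open>The sigma-algebra generated by the maps \<open>f \<mapsto> f x i\<close>. Since these span the dual of the
  \<open>m * n\<close>-dimensional space of linear maps, it is the Borel sigma-algebra of that space. The
  events occurring in \<open>randomly_embeds\<close> belong to it, as norms on \<open>\<real>\<^sup>n\<close> are continuous.\<close>

definition lin_maps_borel :: "nat \<Rightarrow> nat \<Rightarrow> ((nat \<Rightarrow> real) \<Rightarrow> (nat \<Rightarrow> real)) measure" where
  "lin_maps_borel m n =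
     sigma (lin_maps m n)
       {{f \<in> lin_maps m n. f x i \<in> B} | x i B. x \<in> Rn m \<and> i < n \<and> B \<in> sets borel}"

definition randomly_embeds ::
  "nat \<Rightarrow> ((nat \<Rightarrow> real) \<Rightarrow> real) \<Rightarrow> nat \<Rightarrow> ((nat \<Rightarrow> real) \<Rightarrow> real) \<Rightarrow> real \<Rightarrow> bool" where
  "randomly_embeds d X d' U D \<longleftrightarrow>
     (\<exists>\<mu>. prob_space \<mu> \<and> sets \<mu> = sets (lin_maps_borel d d') \<and>
        (\<forall>x\<in>Rn d. measure \<mu> {f \<in> space \<mu>. X x \<le> U (f x) \<and> U (f x) \<le> D * X x} \<ge> 2 / 3))"

end

theory Submission
  imports Defs "HOL-Real_Asymp.Real_Asymp"
begin

text \<open>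
  Take \<open>N = exp (\<Omega>(d / D\<^sup>2))\<close> sign vectors \<open>W\<close> whose pairwise inner products are at most
  \<open>d / (2 D)\<close>. Each \<open>T \<subseteq> W\<close> gives a norm (the maximum of \<open>\<bar>\<langle>x, t\<rangle>\<bar>\<close>, \<open>t \<in> T\<close>, and a small multiple of the
  \<open>\<ell>\<^sub>1\<close> norm) equal to \<open>d\<close> on \<open>T\<close> and at most \<open>d / (2 D)\<close> on \<open>W - T\<close>. By averaging, a single linear map
  \<open>f\<^sub>T\<close> is good on a set \<open>G\<^sub>T \<subseteq> W\<close> with \<open>\<bar>G\<^sub>T\<bar> \<ge> 2 N / 3\<close>, and the values \<open>U (f\<^sub>T u)\<close> decide membership of
  \<open>u \<in> G\<^sub>T\<close> in \<open>T\<close>.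

  Nothing is known about \<open>f\<^sub>T\<close> outside \<open>G\<^sub>T\<close>, so the maps are not compared on all of \<open>W\<close>. Instead fix
  \<open>S \<subseteq> W\<close>: the maps \<open>f\<^sub>T\<close> with \<open>S \<subseteq> G\<^sub>T\<close> are bounded by \<open>D d\<close> on \<open>S\<close>, and two of them with
  \<open>T \<inter> S \<noteq> T' \<inter> S\<close> differ by at least \<open>d / 2\<close> somewhere on \<open>S\<close>, so a packing bound \<open>M\<close> in dimension
  \<open>n = d d'\<close> limits the number of traces \<open>T \<inter> S\<close>. Counting the pairs \<open>S \<subseteq> G\<^sub>T\<close> in both orders gives
  \<open>2\<^sup>N 2\<^bsup>2N/3\<^esup> \<le> \<Sum>\<^sub>S M 2\<^bsup>N - \<bar>S\<bar>\<^esup> = M 3\<^sup>N\<close>. As \<open>2\<^bsup>5/3\<^esup> > 3\<close>, this forces \<open>M\<close> to be exponential in \<open>N\<close>,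
  whereas \<open>log M = O(n\<^sup>2)\<close>.
\<close>

section \<open>Packing bound for families separated by seminorms\<close>

text \<open>
  Induction on the coordinates: subtracting multiples \<open>l i\<close> of a vector with the largest \<open>j\<close>-th entry
  kills coordinate \<open>j\<close>; the \<open>l i\<close> lie in \<open>[-1, 1]\<close>, and within a class of nearly equal \<open>l i\<close> the bound
  \<open>R\<close> at most doubles and the separation \<open>r\<close> at most halves. This is weaker than the volumetric
  bound \<open>(1 + 2 R / r) ^ card J\<close>, but elementary.
\<close>

lemma separated_family_card_le:
  fixes p :: "'u \<Rightarrow> ('j \<Rightarrow> real) \<Rightarrow> real" and a :: "'i \<Rightarrow> 'j \<Rightarrow> real"
  assumes "finite J"
    and tri: "\<And>u x y. u \<in> S \<Longrightarrow> p u (\<lambda>j. x j + y j) \<le> p u x + p u y"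
    and hom: "\<And>u c x. u \<in> S \<Longrightarrow> p u (\<lambda>j. c * x j) = \<bar>c\<bar> * p u x"
    and "finite I"
    and "\<And>i j. i \<in> I \<Longrightarrow> j \<notin> J \<Longrightarrow> a i j = 0"
    and "\<And>i u. i \<in> I \<Longrightarrow> u \<in> S \<Longrightarrow> p u (a i) \<le> R"
    and "\<And>i i'. i \<in> I \<Longrightarrow> i' \<in> I \<Longrightarrow> i \<noteq> i' \<Longrightarrow> \<exists>u\<in>S. r \<le> p u (\<lambda>j. a i j - a i' j)"
    and "0 < r" "r \<le> 2 * R"
  shows "real (card I) \<le> (8 * 4 ^ card J * (R / r)) ^ card J"
  using assms(1,4-)
proof (induction J arbitrary: I a R r rule: finite_induct)
  case empty
  have "i = i'" if ii: "i \<in> I" "i' \<in> I" for i i'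
  proof (rule ccontr)
    assume "i \<noteq> i'"
    then obtain u where u: "u \<in> S" "r \<le> p u (\<lambda>j. a i j - a i' j)"
      using empty.prems(4)[OF ii] by blast
    moreover have "(\<lambda>j. a i j - a i' j) = (\<lambda>j. 0 * a i j)"
      using empty.prems(2) ii by auto
    ultimately show False using hom[OF u(1), of 0 "a i"] \<open>0 < r\<close> by simp
  qed
  then have "card I \<le> 1" using card_le_Suc0_iff_eq[OF \<open>finite I\<close>] by auto
  then show ?case by simp
next
  case (insert j J)
  define \<rho> where "\<rho> = R / r"
  \<comment> \<open>This absorbs the additive constant in the number of cells:
    \<open>4 * \<rho> + 2 \<le> 8 * \<rho>\<close>.\<close>
  have \<rho>: "\<rho> \<ge> 1 / 2" using insert.prems(5,6) by (simp add: \<rho>_def field_simps)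
  show ?case
  proof (cases "I = {}")
    case True
    then show ?thesis using \<rho> by (simp add: \<rho>_def[symmetric])
  next
    case False
    have "Max ((\<lambda>i. \<bar>a i j\<bar>) ` I) \<in> (\<lambda>i. \<bar>a i j\<bar>) ` I"
      using False \<open>finite I\<close> by (intro Max_in) auto
    then obtain b where b: "b \<in> I" "Max ((\<lambda>i. \<bar>a i j\<bar>) ` I) = \<bar>a b j\<bar>" by auto
    have bmax: "\<bar>a i j\<bar> \<le> \<bar>a b j\<bar>" if "i \<in> I" for i
      using Max_ge[of "(\<lambda>i. \<bar>a i j\<bar>) ` I"] b(2) that \<open>finite I\<close> by auto
    \<comment> \<open>If \<open>a b j = 0\<close>, division by zero gives \<open>l i = 0\<close>,
      while \<open>bmax\<close> makes every \<open>a i j\<close> vanish, so coordinate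
      \<open>j\<close> is cleared in this case too.\<close>
    define l where "l i = a i j / a b j" for i
    define a' where "a' i k = a i k - l i * a b k" for i k
    \<comment> \<open>The cell width for \<open>l i\<close> is
      \<open>1 / (2 * \<rho>) = r / (2 * R)\<close>, so that inside a cell the correction
      \<open>(l i - l i') * a b m\<close> costs at most \<open>r / 2\<close> of the
      separation.\<close>
    define cell where "cell i = \<lfloor>l i * (2 * \<rho>)\<rfloor>" for i
    have l1: "\<bar>l i\<bar> \<le> 1" if "i \<in> I" for i
      using bmax[OF that] by (auto simp: l_def abs_divide divide_le_eq_1)
    have R0: "R > 0" using insert.prems(5,6) by simp
    have cells: "cell ` I \<subseteq> {\<lfloor>- (2 * \<rho>)\<rfloor>..\<lfloor>2 * \<rho>\<rfloor>}"
    proof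
      fix k assume "k \<in> cell ` I"
      then obtain i where i: "i \<in> I" "k = cell i" by auto
      have "- 1 * (2 * \<rho>) \<le> l i * (2 * \<rho>)" "l i * (2 * \<rho>) \<le> 1 * (2 * \<rho>)"
        using l1[OF i(1)] \<rho> by (intro mult_right_mono; simp)+
      then show "k \<in> {\<lfloor>- (2 * \<rho>)\<rfloor>..\<lfloor>2 * \<rho>\<rfloor>}"
        unfolding i(2) cell_def by (auto intro!: floor_mono)
    qed
    have "real (card (cell ` I)) \<le> real (card {\<lfloor>- (2 * \<rho>)\<rfloor>..\<lfloor>2 * \<rho>\<rfloor>})"
      using card_mono[OF _ cells] by simp
    also have "\<dots> \<le> 8 * \<rho>"
    proof -
      have "\<lfloor>- (2 * \<rho>)\<rfloor> \<le> \<lfloor>2 * \<rho>\<rfloor>" using \<rho> by (intro floor_mono) simp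
      then have "real (card {\<lfloor>- (2 * \<rho>)\<rfloor>..\<lfloor>2 * \<rho>\<rfloor>})
          = of_int \<lfloor>2 * \<rho>\<rfloor> - of_int \<lfloor>- (2 * \<rho>)\<rfloor> + 1" by simp
      also have "\<dots> \<le> 4 * \<rho> + 2" by linarith
      finally show ?thesis using \<rho> by linarith
    qed
    finally have ncells: "real (card (cell ` I)) \<le> 8 * \<rho>" .
    \<comment> \<open>The ratio \<open>R / r\<close> grows by the factor 4; the power
      \<open>4 ^ card J\<close> in the bound pays one such factor for each coordinate.\<close>
    have sub: "real (card {i \<in> I. cell i = k}) \<le> (8 * 4 ^ card J * (2 * R / (r / 2))) ^ card J"
      for k
    proof (rule insert.IH[where a = a'])
      show "finite {i \<in> I. cell i = k}" using \<open>finite I\<close> by simp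
      show "a' i m = 0" if "i \<in> {i \<in> I. cell i = k}" "m \<notin> J" for i m
      proof (cases "m = j")
        case True
        show ?thesis using bmax[of i] that by (cases "a b j = 0") (auto simp: True a'_def l_def)
      next
        case False
        then show ?thesis using insert.prems(2) b(1) that by (simp add: a'_def)
      qed
      show "p u (a' i) \<le> 2 * R" if i: "i \<in> {i \<in> I. cell i = k}" and u: "u \<in> S" for i u
      proof -
        have "p u (a' i) \<le> p u (a i) + p u (\<lambda>m. (- l i) * a b m)"
          using tri[OF u, of "a i" "\<lambda>m. (- l i) * a b m"] by (simp add: a'_def[abs_def])
        also have "p u (\<lambda>m. (- l i) * a b m) = \<bar>l i\<bar> * p u (a b)" using hom[OF u] by (metis abs_minus_cancel)
        also have "\<dots> \<le> \<bar>l i\<bar> * R" using insert.prems(3)[OF b(1) u] by (intro mult_left_mono) auto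
        also have "\<dots> \<le> 1 * R" using l1 i R0 by (intro mult_right_mono) auto
        finally show ?thesis using insert.prems(3)[of i u] i u by simp
      qed
      show "\<exists>u\<in>S. r / 2 \<le> p u (\<lambda>m. a' i m - a' i' m)"
        if i: "i \<in> {i \<in> I. cell i = k}" "i' \<in> {i \<in> I. cell i = k}" "i \<noteq> i'" for i i'
      proof -
        obtain u where u: "u \<in> S" "r \<le> p u (\<lambda>m. a i m - a i' m)"
          using insert.prems(4)[of i i'] i by auto
        have "\<lfloor>l i * (2 * \<rho>)\<rfloor> = \<lfloor>l i' * (2 * \<rho>)\<rfloor>" using i by (simp add: cell_def)
        then have "\<bar>l i * (2 * \<rho>) - l i' * (2 * \<rho>)\<bar> \<le> 1" by linarith
        then have "\<bar>l i - l i'\<bar> * (2 * \<rho>) \<le> 1"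
          using \<rho> by (simp add: left_diff_distrib[symmetric] abs_mult)
        then have *: "\<bar>l i - l i'\<bar> * R \<le> r / 2"
          using insert.prems(5) by (simp add: \<rho>_def field_simps)
        have "p u (\<lambda>m. a i m - a i' m)
            = p u (\<lambda>m. (a' i m - a' i' m) + (l i - l i') * a b m)"
          by (rule arg_cong[where f = "p u"]) (auto simp: a'_def algebra_simps)
        also have "\<dots> \<le> p u (\<lambda>m. a' i m - a' i' m) + p u (\<lambda>m. (l i - l i') * a b m)"
          by (rule tri[OF u(1)])
        also have "p u (\<lambda>m. (l i - l i') * a b m) = \<bar>l i - l i'\<bar> * p u (a b)"
          by (rule hom[OF u(1)])
        also have "\<dots> \<le> \<bar>l i - l i'\<bar> * R"
          using insert.prems(3)[OF b(1) u(1)] by (intro mult_left_mono) auto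
        finally show ?thesis using * u by (intro bexI[of _ u]) auto
      qed
    qed (use insert.prems R0 in auto)
    have "real (card I) = (\<Sum>k\<in>cell ` I. real (card {i \<in> I. cell i = k}))"
      using sum.image_gen[OF \<open>finite I\<close>, of "\<lambda>_. 1::real" cell] by simp
    also have "\<dots> \<le> (\<Sum>k\<in>cell ` I. (8 * 4 ^ card J * (4 * \<rho>)) ^ card J)"
      using sub by (intro sum_mono) (simp add: \<rho>_def)
    also have "\<dots> = real (card (cell ` I)) * (8 * 4 ^ Suc (card J) * \<rho>) ^ card J" by (simp add: mult_ac)
    also have "\<dots> \<le> (8 * \<rho>) * (8 * 4 ^ Suc (card J) * \<rho>) ^ card J"
      using ncells \<rho> by (intro mult_right_mono) auto
    also have "\<dots> \<le> (8 * 4 ^ Suc (card J) * \<rho>) * (8 * 4 ^ Suc (card J) * \<rho>) ^ card J"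
    proof (rule mult_right_mono)
      have "(1::real) \<le> 4 ^ Suc (card J)" by (rule one_le_power) simp
      then show "8 * \<rho> \<le> 8 * 4 ^ Suc (card J) * \<rho>" using \<rho> by simp
    qed (use \<rho> in auto)
    finally show ?thesis using insert.hyps by (simp add: \<rho>_def)
  qed
qed

section \<open>Almost orthogonal sign vectors\<close>

definition dot :: "nat \<Rightarrow> (nat \<Rightarrow> real) \<Rightarrow> (nat \<Rightarrow> real) \<Rightarrow> real" where
  "dot d x y = (\<Sum>i<d. x i * y i)"

definition sign_vec :: "nat \<Rightarrow> nat set \<Rightarrow> nat \<Rightarrow> real" where
  "sign_vec d A i = (if i < d then if i \<in> A then 1 else - 1 else 0)"

text \<open>The exponential moment of one random sign. The quadratic bounds
  \<open>1 + s + s\<^sup>2\<close> and \<open>1 - s + s\<^sup>2\<close> on the two exponentials add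
  up to \<open>2 * (1 + s\<^sup>2)\<close>, the linear terms cancelling.\<close>

lemma exp_add_exp_minus_le:
  fixes t :: real
  assumes "\<bar>t\<bar> \<le> 1"
  shows "exp t + exp (- t) \<le> 2 * exp (t\<^sup>2)"
proof -
  have *: "exp s + exp (- s) \<le> 2 * exp (s\<^sup>2)" if s: "0 \<le> s" "s \<le> 1" for s :: real
  proof -
    have "exp (- s) \<le> 1 - s + s\<^sup>2"
    proof -
      \<comment> \<open>The product equals \<open>1 + s ^ 3\<close>.\<close>
      have "1 \<le> (1 - s + s\<^sup>2) * (1 + s)"
        using s by (simp add: algebra_simps power2_eq_square)
      also have "\<dots> \<le> (1 - s + s\<^sup>2) * exp s"
        using s by (intro mult_left_mono exp_ge_add_one_self) auto
      finally show ?thesis by (simp add: exp_minus field_simps)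
    qed
    moreover have "exp s \<le> 1 + s + s\<^sup>2" using exp_bound s by simp
    moreover have "1 + s\<^sup>2 \<le> exp (s\<^sup>2)" by (rule exp_ge_add_one_self)
    ultimately show ?thesis by linarith
  qed
  show ?thesis
    using *[of t] *[of "- t"] assms by (cases "t \<ge> 0") auto
qed

text \<open>Chernoff bound, with counts in place of probabilities: Markov's inequality is applied to
  the exponential moment of the inner product, which factorises over the coordinates.\<close>

lemma card_correlated_signs_le:
  fixes u :: "nat \<Rightarrow> real"
  assumes u: "\<And>i. i < d \<Longrightarrow> \<bar>u i\<bar> = 1" and g: "0 \<le> \<gamma>" "\<gamma> \<le> 1"
  shows "real (card {B \<in> Pow {..<d}. \<gamma> * d < dot d u (sign_vec d B)})
    \<le> 2 ^ d * exp (- (\<gamma>\<^sup>2 * d / 4))"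
proof -
  let ?E = "{B \<in> Pow {..<d}. \<gamma> * d < dot d u (sign_vec d B)}"
  \<comment> \<open>This value minimises the final exponent
    \<open>t\<^sup>2 * d - t * (\<gamma> * d)\<close>.\<close>
  define t where "t = \<gamma> / 2"
  have t: "0 \<le> t" "t \<le> 1" using g by (auto simp: t_def)
  have "real (card ?E) * exp (t * (\<gamma> * d)) = (\<Sum>B\<in>?E. exp (t * (\<gamma> * d)))" by simp
  also have "\<dots> \<le> (\<Sum>B\<in>?E. exp (t * dot d u (sign_vec d B)))"
    using t by (intro sum_mono) (auto intro!: mult_left_mono)
  also have "\<dots> \<le> (\<Sum>B\<in>Pow {..<d}. exp (t * dot d u (sign_vec d B)))"
    by (intro sum_mono2) auto
  also have "\<dots> = (\<Sum>B\<in>Pow {..<d}. (\<Prod>i\<in>B. exp (t * u i)) * (\<Prod>i\<in>{..<d} - B. exp (- (t * u i))))"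
  proof (rule sum.cong)
    fix B assume B: "B \<in> Pow {..<d}"
    have "exp (t * dot d u (sign_vec d B)) = (\<Prod>i<d. exp (t * u i * sign_vec d B i))"
      by (simp add: dot_def sum_distrib_left exp_sum mult_ac)
    also have "\<dots> = (\<Prod>i\<in>{..<d} - B. exp (t * u i * sign_vec d B i))
        * (\<Prod>i\<in>B. exp (t * u i * sign_vec d B i))"
      using B by (intro prod.subset_diff) auto
    also have "(\<Prod>i\<in>B. exp (t * u i * sign_vec d B i)) = (\<Prod>i\<in>B. exp (t * u i))"
      using B by (intro prod.cong) (auto simp: sign_vec_def)
    also have "(\<Prod>i\<in>{..<d} - B. exp (t * u i * sign_vec d B i)) = (\<Prod>i\<in>{..<d} - B. exp (- (t * u i)))"
      by (intro prod.cong) (auto simp: sign_vec_def)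
    finally show "exp (t * dot d u (sign_vec d B))
        = (\<Prod>i\<in>B. exp (t * u i)) * (\<Prod>i\<in>{..<d} - B. exp (- (t * u i)))"
      by (simp add: mult.commute)
  qed simp
  also have "\<dots> = (\<Prod>i<d. exp (t * u i) + exp (- (t * u i)))"
    by (simp add: prod_add)
  also have "\<dots> \<le> (\<Prod>i<d. 2 * exp (t\<^sup>2))"
  proof (rule prod_mono, safe)
    fix i assume "i < d"
    then have "\<bar>t * u i\<bar> \<le> 1" "(t * u i)\<^sup>2 = t\<^sup>2"
      using u[of i] t by (auto simp: abs_mult power_mult_distrib power2_eq_1_iff abs_if split: if_splits)
    then show "exp (t * u i) + exp (- (t * u i)) \<le> 2 * exp (t\<^sup>2)"
      using exp_add_exp_minus_le by metis
  qed (simp add: add_nonneg_nonneg)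
  also have "\<dots> = 2 ^ d * exp (t\<^sup>2 * d)"
    by (simp add: power_mult_distrib exp_of_nat_mult[symmetric] mult.commute)
  finally have "real (card ?E) \<le> 2 ^ d * (exp (t\<^sup>2 * d) / exp (t * (\<gamma> * d)))"
    by (simp add: field_simps)
  also have "exp (t\<^sup>2 * d) / exp (t * (\<gamma> * d)) = exp (- (\<gamma>\<^sup>2 * d / 4))"
    by (simp add: exp_diff[symmetric] t_def power2_eq_square field_simps)
  finally show ?thesis .
qed

text \<open>In a maximal almost orthogonal family \<open>W\<close>, every sign vector is strongly
  correlated with \<open>u\<close> or \<open>- u\<close> for some \<open>u \<in> W\<close>. So
  \<open>2 * card W\<close> caps cover the cube, and each is small by
  \<open>card_correlated_signs_le\<close>.\<close>

lemma almost_orthogonal_signs_exist: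
  fixes \<gamma> :: real
  assumes d: "0 < d" and g: "0 \<le> \<gamma>" "\<gamma> < 1"
  obtains W where "finite W" "W \<subseteq> Rn d" "\<And>u i. u \<in> W \<Longrightarrow> i < d \<Longrightarrow> \<bar>u i\<bar> = 1"
    "\<And>u v. u \<in> W \<Longrightarrow> v \<in> W \<Longrightarrow> u \<noteq> v \<Longrightarrow> \<bar>dot d u v\<bar> \<le> \<gamma> * d"
    "exp (\<gamma>\<^sup>2 * d / 4) \<le> 2 * real (card W)"
proof -
  let ?V = "sign_vec d ` Pow {..<d}"
  let ?Q = "{W. W \<subseteq> ?V \<and> pairwise (\<lambda>u v. \<bar>dot d u v\<bar> \<le> \<gamma> * d) W}"
  have "finite ?Q" by (rule finite_subset[of _ "Pow ?V"]) auto
  moreover have "?Q \<noteq> {}" by (auto intro!: exI[of _ "{}"])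
  ultimately have "\<exists>W\<in>?Q. \<forall>W'\<in>?Q. W \<subseteq> W' \<longrightarrow> W = W'" by (rule finite_has_maximal)
  then obtain W where W: "W \<in> ?Q" and Wmax: "\<forall>W'\<in>?Q. W \<subseteq> W' \<longrightarrow> W = W'" ..
  have finW: "finite W" using W finite_subset[of W ?V] by auto
  have sgn: "\<bar>sign_vec d B i\<bar> = 1" if "i < d" for B i using that by (simp add: sign_vec_def)
  have W1: "\<bar>u i\<bar> = 1" if "u \<in> W" "i < d" for u i using W that sgn by auto
  let ?E = "\<lambda>u. {B \<in> Pow {..<d}. \<gamma> * d < dot d u (sign_vec d B)}"
  have "Pow {..<d} \<subseteq> (\<Union>u\<in>W. ?E u \<union> ?E (\<lambda>i. - u i))"
  proof
    fix B assume B: "B \<in> Pow {..<d}"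
    let ?b = "sign_vec d B"
    have neg: "dot d (\<lambda>i. - u i) ?b = - dot d u ?b" for u
      by (simp add: dot_def sum_negf)
    have "\<exists>u\<in>W. \<gamma> * d < \<bar>dot d u ?b\<bar>"
    proof (cases "?b \<in> W")
      case True
      \<comment> \<open>A member of \<open>W\<close> is covered by its own cap because
        \<open>\<gamma> < 1\<close>.\<close>
      have "dot d ?b ?b = (\<Sum>i<d. 1)"
        unfolding dot_def by (intro sum.cong) (auto simp: sign_vec_def)
      then have "\<gamma> * d < \<bar>dot d ?b ?b\<bar>" using d g by simp
      then show ?thesis using True by blast
    next
      case False
      then have "insert ?b W \<notin> ?Q" using Wmax by blast
      then obtain u where "u \<in> W" "\<not> \<bar>dot d ?b u\<bar> \<le> \<gamma> * d \<or> \<not> \<bar>dot d u ?b\<bar> \<le> \<gamma> * d"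
        using W B by (auto simp: pairwise_insert)
      moreover have "dot d ?b u = dot d u ?b" by (simp add: dot_def mult.commute)
      ultimately show ?thesis by (intro bexI[of _ u]) auto
    qed
    then show "B \<in> (\<Union>u\<in>W. ?E u \<union> ?E (\<lambda>i. - u i))" using B neg by (auto simp: abs_if split: if_splits)
  qed
  then have "card (Pow {..<d}) \<le> card (\<Union>u\<in>W. ?E u \<union> ?E (\<lambda>i. - u i))"
    using finW by (intro card_mono) auto
  also have "\<dots> \<le> (\<Sum>u\<in>W. card (?E u \<union> ?E (\<lambda>i. - u i)))" by (rule card_UN_le[OF finW])
  also have "\<dots> \<le> (\<Sum>u\<in>W. card (?E u) + card (?E (\<lambda>i. - u i)))"
    by (intro sum_mono card_Un_le)
  finally have "real (card (Pow {..<d})) \<le> (\<Sum>u\<in>W. real (card (?E u)) + real (card (?E (\<lambda>i. - u i))))"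
    by (simp flip: of_nat_add of_nat_sum)
  also have "\<dots> \<le> (\<Sum>u\<in>W. 2 ^ d * exp (- (\<gamma>\<^sup>2 * d / 4)) + 2 ^ d * exp (- (\<gamma>\<^sup>2 * d / 4)))"
    using g W1 by (intro sum_mono add_mono card_correlated_signs_le) auto
  finally have "2 ^ d * 1 \<le> 2 ^ d * (2 * real (card W) * exp (- (\<gamma>\<^sup>2 * d / 4)))"
    by (simp add: card_Pow)
  then have "1 \<le> 2 * real (card W) * exp (- (\<gamma>\<^sup>2 * d / 4))" by (simp del: mult_1_right)
  then have "exp (\<gamma>\<^sup>2 * d / 4) \<le> 2 * real (card W)"
    by (simp add: exp_minus field_simps)
  show thesis
  proof (rule that)
    show "W \<subseteq> Rn d" using W by (auto simp: topspace_Euclidean_space sign_vec_def)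
    show "\<bar>dot d u v\<bar> \<le> \<gamma> * d" if "u \<in> W" "v \<in> W" "u \<noteq> v" for u v
      using W that by (auto simp: pairwise_def)
  qed fact+
qed

section \<open>Norms that encode sets of sign vectors\<close>

text \<open>For \<open>\<gamma> > 0\<close> the l1 term makes this definite even when
  \<open>T\<close> does not span, and it keeps the set under \<open>Max\<close> nonempty. On sign
  vectors it equals \<open>\<gamma> * d\<close>, the same bound that holds for inner products of
  distinct members of \<open>W\<close>.\<close>

definition test_norm :: "nat \<Rightarrow> real \<Rightarrow> (nat \<Rightarrow> real) set \<Rightarrow> (nat \<Rightarrow> real) \<Rightarrow> real" where
  "test_norm d \<gamma> T x = Max (insert (\<gamma> * (\<Sum>i<d. \<bar>x i\<bar>)) ((\<lambda>t. \<bar>dot d x t\<bar>) ` T))"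

lemma test_norm_le_iff:
  "finite T \<Longrightarrow> test_norm d \<gamma> T x \<le> b \<longleftrightarrow> \<gamma> * (\<Sum>i<d. \<bar>x i\<bar>) \<le> b \<and> (\<forall>t\<in>T. \<bar>dot d x t\<bar> \<le> b)"
  by (auto simp: test_norm_def)

lemma test_norm_ge:
  assumes "finite T"
  shows "\<gamma> * (\<Sum>i<d. \<bar>x i\<bar>) \<le> test_norm d \<gamma> T x" "t \<in> T \<Longrightarrow> \<bar>dot d x t\<bar> \<le> test_norm d \<gamma> T x"
  using assms by (auto simp: test_norm_def)

lemma norm_on_test_norm:
  assumes T: "finite T" and g: "\<gamma> > 0"
  shows "norm_on d (test_norm d \<gamma> T)"
proof -
  let ?N = "test_norm d \<gamma> T"
  have hom: "?N (\<lambda>i. c * x i) = \<bar>c\<bar> * ?N x" for c x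
  proof -
    have "mono (\<lambda>z. \<bar>c\<bar> * z)" by (intro monoI mult_left_mono) auto
    then have "\<bar>c\<bar> * ?N x
        = Max ((\<lambda>z. \<bar>c\<bar> * z) ` insert (\<gamma> * (\<Sum>i<d. \<bar>x i\<bar>)) ((\<lambda>t. \<bar>dot d x t\<bar>) ` T))"
      unfolding test_norm_def using T by (intro mono_Max_commute) auto
    also have "(\<lambda>z. \<bar>c\<bar> * z) ` insert (\<gamma> * (\<Sum>i<d. \<bar>x i\<bar>)) ((\<lambda>t. \<bar>dot d x t\<bar>) ` T)
        = insert (\<gamma> * (\<Sum>i<d. \<bar>c * x i\<bar>)) ((\<lambda>t. \<bar>dot d (\<lambda>i. c * x i) t\<bar>) ` T)"
      by (simp add: image_image dot_def abs_mult sum_distrib_left[symmetric] mult.assoc mult.left_commute)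
    finally show ?thesis by (simp add: test_norm_def)
  qed
  have nonneg: "0 \<le> ?N x" for x
    using test_norm_ge(1)[OF T, of \<gamma> x d] g
    by (smt (verit) mult_nonneg_nonneg sum_nonneg abs_ge_zero)
  have "x = (\<lambda>_. 0)" if x: "x \<in> Rn d" "?N x = 0" for x
  proof -
    have "\<gamma> * (\<Sum>i<d. \<bar>x i\<bar>) \<le> 0" using test_norm_ge(1)[OF T, of \<gamma> x d] x by simp
    then have "(\<Sum>i<d. \<bar>x i\<bar>) \<le> 0" using g by (simp add: mult_le_0_iff)
    then have "(\<Sum>i<d. \<bar>x i\<bar>) = 0" by (intro antisym sum_nonneg) auto
    then have "\<forall>i<d. x i = 0" by (simp add: sum_nonneg_eq_0_iff)
    then show ?thesis using x(1) by (auto simp: topspace_Euclidean_space not_less) (metis not_less)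
  qed
  moreover have "?N (\<lambda>_. 0) = 0" using hom[of 0 "\<lambda>_. 0"] by simp
  moreover have "?N (\<lambda>i. x i + y i) \<le> ?N x + ?N y" for x y
  proof -
    have "\<gamma> * (\<Sum>i<d. \<bar>x i + y i\<bar>) \<le> \<gamma> * ((\<Sum>i<d. \<bar>x i\<bar>) + (\<Sum>i<d. \<bar>y i\<bar>))"
      using g by (intro mult_left_mono) (auto simp: sum.distrib[symmetric] intro!: sum_mono)
    also have "\<dots> \<le> ?N x + ?N y"
      using test_norm_ge(1)[OF T, of \<gamma> x d] test_norm_ge(1)[OF T, of \<gamma> y d]
      by (simp add: distrib_left)
    finally have "\<gamma> * (\<Sum>i<d. \<bar>x i + y i\<bar>) \<le> ?N x + ?N y" .
    moreover have "\<bar>dot d (\<lambda>i. x i + y i) t\<bar> \<le> ?N x + ?N y" if "t \<in> T" for t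
    proof -
      have "dot d (\<lambda>i. x i + y i) t = dot d x t + dot d y t"
        by (simp add: dot_def sum.distrib distrib_right)
      then show ?thesis
        using test_norm_ge(2)[OF T that, where d = d and \<gamma> = \<gamma>, of x]
          test_norm_ge(2)[OF T that, where d = d and \<gamma> = \<gamma>, of y] by linarith
    qed
    ultimately show ?thesis using T by (simp add: test_norm_le_iff)
  qed
  ultimately show ?thesis unfolding norm_on_def using hom nonneg by blast
qed

section \<open>Linear maps as matrices\<close>

definition matrix_apply :: "nat \<Rightarrow> nat \<Rightarrow> (nat \<times> nat \<Rightarrow> real) \<Rightarrow> (nat \<Rightarrow> real) \<Rightarrow> nat \<Rightarrow> real" where
  "matrix_apply m n a x = (\<lambda>i. if i < n then \<Sum>k<m. a (i, k) * x k else 0)"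

lemma matrix_apply_in_Rn: "matrix_apply m n a x \<in> Rn n"
  by (simp add: matrix_apply_def topspace_Euclidean_space)

lemma lin_maps_matrix:
  assumes f: "f \<in> lin_maps m n"
  obtains a where "\<And>j. j \<notin> {..<n} \<times> {..<m} \<Longrightarrow> a j = 0"
    "\<And>x. x \<in> Rn m \<Longrightarrow> f x = matrix_apply m n a x"
proof -
  define e where "e k = (\<lambda>i. if i = k then 1 else 0::real)" for k :: nat
  define a where "a = (\<lambda>(i, k). if i < n \<and> k < m then f (e k) i else 0)"
  have fadd: "f (\<lambda>i. x i + y i) = (\<lambda>i. f x i + f y i)" if "x \<in> Rn m" "y \<in> Rn m" for x y
    using f that by (simp add: lin_maps_def)
  have fmult: "f (\<lambda>i. c * x i) = (\<lambda>i. c * f x i)" if "x \<in> Rn m" for c x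
    using f that by (simp add: lin_maps_def)
  have e_in: "e k \<in> Rn m" if "k < m" for k
    using that by (auto simp: e_def topspace_Euclidean_space)
  \<comment> \<open>Truncations of \<open>x\<close> are built up one basis vector at a time; at
    \<open>l = m\<close> the truncation of a vector in \<open>Rn m\<close> is the vector
    itself.\<close>
  have partial: "f (\<lambda>i. if i < l then x i else 0) = (\<lambda>i. \<Sum>k<l. f (e k) i * x k)"
    if "l \<le> m" for l x
    using that
  proof (induction l)
    case 0
    show ?case using fmult[of "\<lambda>_. 0" 0] by (simp add: topspace_Euclidean_space)
  next
    case (Suc l)
    have "(\<lambda>i. if i < Suc l then x i else 0) = (\<lambda>i. (if i < l then x i else 0) + x l * e l i)"
      by (auto simp: e_def fun_eq_iff less_Suc_eq)
    moreover have "(\<lambda>i. if i < l then x i else 0) \<in> Rn m" "(\<lambda>i. x l * e l i) \<in> Rn m"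
      using Suc.prems by (auto simp: topspace_Euclidean_space e_def)
    ultimately show ?case
      using Suc fadd fmult[OF e_in, of l "x l"] by (simp add: mult.commute)
  qed
  have "f x = matrix_apply m n a x" if x: "x \<in> Rn m" for x
  proof -
    have "(\<lambda>i. if i < m then x i else 0) = x"
      using x by (auto simp: topspace_Euclidean_space fun_eq_iff)
    then have fx: "f x = (\<lambda>i. \<Sum>k<m. f (e k) i * x k)" using partial[of m x] by simp
    have "f x i = 0" if "i \<ge> n" for i
      using f x that by (auto simp: lin_maps_def topspace_Euclidean_space PiE_def Pi_def)
    then show ?thesis unfolding matrix_apply_def a_def using fx by (auto simp: fun_eq_iff)
  qed
  moreover have "a j = 0" if "j \<notin> {..<n} \<times> {..<m}" for j
    using that by (auto simp: a_def split: prod.splits)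
  ultimately show thesis using that[of a] by blast
qed

section \<open>Averaging over the random embedding\<close>

text \<open>First moment argument: by linearity the expected number of points of \<open>W\<close> on
  which the map is good is at least \<open>2 / 3 * card W\<close>, so it cannot be smaller than this
  for every map.\<close>

lemma randomly_embeds_good_map:
  assumes emb: "randomly_embeds d X d' U D" and W: "finite W" "W \<subseteq> Rn d"
  shows "\<exists>f\<in>lin_maps d d'. 2 * card W \<le> 3 * card {u \<in> W. X u \<le> U (f u) \<and> U (f u) \<le> D * X u}"
proof -
  obtain \<mu> where \<mu>: "prob_space \<mu>" "sets \<mu> = sets (lin_maps_borel d d')"
    and pr: "\<And>x. x \<in> Rn d \<Longrightarrow> 2 / 3 \<le> measure \<mu> {f \<in> space \<mu>. X x \<le> U (f x) \<and> U (f x) \<le> D * X x}"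
    using emb unfolding randomly_embeds_def by blast
  interpret prob_space \<mu> by fact
  let ?E = "\<lambda>u. {f \<in> space \<mu>. X u \<le> U (f u) \<and> U (f u) \<le> D * X u}"
  let ?c = "\<lambda>f. card {u \<in> W. X u \<le> U (f u) \<and> U (f u) \<le> D * X u}"
  have space: "space \<mu> = lin_maps d d'"
    using sets_eq_imp_space_eq[OF \<mu>(2)] by (simp add: lin_maps_borel_def space_measure_of_conv)
  \<comment> \<open>Non-measurable sets have \<open>measure\<close> 0, so the probability bound entails measurability.\<close>
  have meas: "?E u \<in> sets \<mu>" if "u \<in> W" for u
    using pr[of u] that W measure_notin_sets[of "?E u" \<mu>] by force
  have "\<exists>f\<in>space \<mu>. 2 * card W \<le> 3 * ?c f"
  proof (rule ccontr)
    assume "\<not> ?thesis"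
    then have lt: "3 * ?c f < 2 * card W" if "f \<in> space \<mu>" for f using that by force
    have int: "integrable \<mu> (\<lambda>f. \<Sum>u\<in>W. indicator (?E u) f :: real)"
      using meas by (intro Bochner_Integration.integrable_sum integrable_real_indicator) (auto simp: emeasure_eq_measure)
    have "(\<Sum>u\<in>W. indicator (?E u) f) = real (?c f)" if "f \<in> space \<mu>" for f
    proof -
      have "(\<Sum>u\<in>W. indicator (?E u) f) = (\<Sum>u\<in>W. if X u \<le> U (f u) \<and> U (f u) \<le> D * X u then 1 else 0::real)"
        using that by (intro sum.cong) (auto simp: indicator_def)
      then show ?thesis using W(1) by (simp add: sum.If_cases Int_def)
    qed
    then have "(\<Sum>u\<in>W. indicator (?E u) f) < 2 / 3 * real (card W)" if "f \<in> space \<mu>" for f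
      using lt[OF that] that by simp
    then have "expectation (\<lambda>f. \<Sum>u\<in>W. indicator (?E u) f) < 2 / 3 * real (card W)"
      using int by (intro expectation_less) auto
    also have "2 / 3 * real (card W) = (\<Sum>u\<in>W. 2 / 3)" by simp
    also have "\<dots> \<le> (\<Sum>u\<in>W. prob (?E u))" using pr W by (intro sum_mono) auto
    also have "\<dots> = (\<Sum>u\<in>W. expectation (indicator (?E u)))"
      using meas by (intro sum.cong) auto
    also have "\<dots> = expectation (\<lambda>f. \<Sum>u\<in>W. indicator (?E u) f)"
      using meas by (intro Bochner_Integration.integral_sum[symmetric] integrable_real_indicator)
        (auto simp: emeasure_eq_measure)
    finally show False by simp
  qed
  then show ?thesis by (simp only: space)
qed

section \<open>Double counting of traces\<close>

text \<open>Expansion of \<open>(1 + 2) ^ card W\<close>: an element has weight 1 inside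
  \<open>S\<close> and weight 2 outside.\<close>

lemma sum_two_power_card_diff:
  assumes "finite W"
  shows "(\<Sum>S\<in>Pow W. 2 ^ card (W - S)) = (3::real) ^ card W"
  using prod_add[OF assms, of "\<lambda>_. 1::real" "\<lambda>_. 2"] by simp

text \<open>Double counting of the pairs with \<open>S \<subseteq> G T\<close>. A given
  \<open>T\<close> has \<open>2 ^ card (G T)\<close> partners; for a given \<open>S\<close>, the set
  \<open>T\<close> is determined by its trace \<open>T \<inter> S\<close>, with at most
  \<open>M\<close> values, and by \<open>T - S\<close>.\<close>

lemma shattering_count:
  fixes G :: "'a set \<Rightarrow> 'a set" and M :: real
  assumes W: "finite W"
    and G: "\<And>T. T \<subseteq> W \<Longrightarrow> G T \<subseteq> W" "\<And>T. T \<subseteq> W \<Longrightarrow> 2 * card W \<le> 3 * card (G T)"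
    and M: "\<And>S. S \<subseteq> W \<Longrightarrow> real (card ((\<lambda>T. T \<inter> S) ` {T \<in> Pow W. S \<subseteq> G T})) \<le> M"
  shows "2 powr (5 / 3 * real (card W)) \<le> M * 3 ^ card W"
proof -
  let ?A = "\<lambda>S. {T \<in> Pow W. S \<subseteq> G T}"
  have A: "real (card (?A S)) \<le> M * 2 ^ card (W - S)" if S: "S \<subseteq> W" for S
  proof -
    have "inj_on (\<lambda>T. (T \<inter> S, T - S)) (?A S)" by (auto simp: inj_on_def)
    moreover have "(\<lambda>T. (T \<inter> S, T - S)) ` ?A S \<subseteq> ((\<lambda>T. T \<inter> S) ` ?A S) \<times> Pow (W - S)" by auto
    ultimately have "card (?A S) \<le> card (((\<lambda>T. T \<inter> S) ` ?A S) \<times> Pow (W - S))"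
      using W by (intro card_inj_on_le) auto
    also have "\<dots> = card ((\<lambda>T. T \<inter> S) ` ?A S) * 2 ^ card (W - S)"
      using W by (simp add: card_cartesian_product card_Pow)
    finally have "real (card (?A S)) \<le> real (card ((\<lambda>T. T \<inter> S) ` ?A S) * 2 ^ card (W - S))"
      by (rule of_nat_mono)
    then have "real (card (?A S)) \<le> real (card ((\<lambda>T. T \<inter> S) ` ?A S)) * 2 ^ card (W - S)" by simp
    also have "\<dots> \<le> M * 2 ^ card (W - S)" using M[OF S] by (intro mult_right_mono) auto
    finally show ?thesis .
  qed
  have "2 powr (5 / 3 * real (card W)) = 2 ^ card W * 2 powr (2 / 3 * real (card W))"
    by (simp add: powr_realpow[symmetric] powr_add[symmetric])
  also have "\<dots> = (\<Sum>T\<in>Pow W. 2 powr (2 / 3 * real (card W)))" using W by (simp add: card_Pow)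
  also have "\<dots> \<le> (\<Sum>T\<in>Pow W. 2 powr real (card (G T)))"
  proof (intro sum_mono powr_mono)
    fix T assume "T \<in> Pow W"
    then have "real (2 * card W) \<le> real (3 * card (G T))" using G(2)[of T] by (intro of_nat_mono) auto
    then show "2 / 3 * real (card W) \<le> real (card (G T))" by simp
  qed simp
  also have "\<dots> = (\<Sum>T\<in>Pow W. real (card {S \<in> Pow W. S \<subseteq> G T}))"
  proof (rule sum.cong)
    fix T assume "T \<in> Pow W"
    then have "{S \<in> Pow W. S \<subseteq> G T} = Pow (G T)" "finite (G T)"
      using G(1)[of T] W finite_subset by auto
    then show "2 powr real (card (G T)) = real (card {S \<in> Pow W. S \<subseteq> G T})"
      by (simp add: card_Pow powr_realpow)
  qed simp
  also have "\<dots> = (\<Sum>S\<in>Pow W. real (card (?A S)))"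
    using sum_multicount_gen[of "Pow W" "Pow W" "\<lambda>T S. S \<subseteq> G T" "\<lambda>S. card (?A S)"] W
    by (simp flip: of_nat_sum)
  also have "\<dots> \<le> (\<Sum>S\<in>Pow W. M * 2 ^ card (W - S))" using A by (intro sum_mono) auto
  also have "\<dots> = M * 3 ^ card W"
    using sum_two_power_card_diff[OF W] by (simp add: sum_distrib_left[symmetric])
  finally show ?thesis .
qed

section \<open>The bound on the dimension\<close>

text \<open>The packing bound is applied to the matrices of the maps, with one seminorm, the
  \<open>U\<close>-norm of the image of \<open>u\<close>, for each \<open>u \<in> S\<close>. Two
  different traces differ at some \<open>u\<close>, where one image has norm at least
  \<open>d\<close> and the other at most \<open>d / 2\<close>; this gives separation
  \<open>d / 2\<close> under the bound \<open>D * d\<close>.\<close>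

lemma patterns_card_le:
  assumes U: "norm_on d' U" and d: "0 < d" and D: "1 \<le> D" and S: "S \<subseteq> Rn d"
    and T: "finite \<T>"
    and f: "\<And>T. T \<in> \<T> \<Longrightarrow> F T \<in> lin_maps d d'"
    and bd: "\<And>T u. T \<in> \<T> \<Longrightarrow> u \<in> S \<Longrightarrow> U (F T u) \<le> D * d"
    and ins: "\<And>T u. T \<in> \<T> \<Longrightarrow> u \<in> S \<Longrightarrow> u \<in> T \<Longrightarrow> d \<le> U (F T u)"
    and out: "\<And>T u. T \<in> \<T> \<Longrightarrow> u \<in> S \<Longrightarrow> u \<notin> T \<Longrightarrow> U (F T u) \<le> d / 2"
  shows "real (card ((\<lambda>T. T \<inter> S) ` \<T>)) \<le> (8 * 4 ^ (d' * d) * (2 * D)) ^ (d' * d)"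
proof -
  let ?J = "{..<d'} \<times> {..<d}"
  define p where "p u a = U (matrix_apply d d' a u)" for u a
  have "\<exists>a. (\<forall>j. j \<notin> ?J \<longrightarrow> a j = 0) \<and> (\<forall>x\<in>Rn d. F T x = matrix_apply d d' a x)"
    if "T \<in> \<T>" for T
    using lin_maps_matrix[OF f[OF that]] by metis
  then obtain A where A0: "\<And>T j. T \<in> \<T> \<Longrightarrow> j \<notin> ?J \<Longrightarrow> A T j = 0"
    and A: "\<And>T x. T \<in> \<T> \<Longrightarrow> x \<in> Rn d \<Longrightarrow> F T x = matrix_apply d d' (A T) x"
    by metis
  have pA: "p u (A T) = U (F T u)" if "T \<in> \<T>" "u \<in> S" for T u
    using A S that by (auto simp: p_def)
  have Utri: "U (\<lambda>i. x i + y i) \<le> U x + U y" if "x \<in> Rn d'" "y \<in> Rn d'" for x y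
    using U that by (simp add: norm_on_def)
  have Uhom: "U (\<lambda>i. c * x i) = \<bar>c\<bar> * U x" if "x \<in> Rn d'" for c x
    using U that by (simp add: norm_on_def)
  have tri: "p u (\<lambda>j. x j + y j) \<le> p u x + p u y" for u x y
  proof -
    have "matrix_apply d d' (\<lambda>j. x j + y j) u = (\<lambda>i. matrix_apply d d' x u i + matrix_apply d d' y u i)"
      by (auto simp: matrix_apply_def sum.distrib distrib_right)
    then show ?thesis by (simp add: p_def Utri matrix_apply_in_Rn)
  qed
  have hom: "p u (\<lambda>j. c * x j) = \<bar>c\<bar> * p u x" for u c x
  proof -
    have "matrix_apply d d' (\<lambda>j. c * x j) u = (\<lambda>i. c * matrix_apply d d' x u i)"
      by (auto simp: matrix_apply_def sum_distrib_left mult.assoc)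
    then show ?thesis by (simp add: p_def Uhom matrix_apply_in_Rn)
  qed
  have diff: "p u x - p u y \<le> p u (\<lambda>j. x j - y j)" for u x y
    using tri[of u "\<lambda>j. x j - y j" y] by simp
  have diff': "p u y - p u x \<le> p u (\<lambda>j. x j - y j)" for u x y
    using diff[of u y x] hom[of u "-1" "\<lambda>j. x j - y j"] by simp
  \<comment> \<open>One set is chosen for each trace, so that the packed family is indexed by the
    traces themselves.\<close>
  define rep where "rep = inv_into \<T> (\<lambda>T. T \<inter> S)"
  let ?I = "(\<lambda>T. T \<inter> S) ` \<T>"
  have rep: "rep Q \<in> \<T>" "rep Q \<inter> S = Q" if "Q \<in> ?I" for Q
    using that inv_into_into[OF that] f_inv_into_f[OF that] by (auto simp: rep_def)
  have "real (card ?I) \<le> (8 * 4 ^ card ?J * (D * d / (d / 2))) ^ card ?J"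
  proof (rule separated_family_card_le[where S = S and p = p and a = "\<lambda>Q. A (rep Q)"])
    show "p u (A (rep Q)) \<le> D * d" if "Q \<in> ?I" "u \<in> S" for Q u
      using pA bd rep(1)[OF that(1)] that(2) by simp
    show "\<exists>u\<in>S. d / 2 \<le> p u (\<lambda>j. A (rep Q) j - A (rep Q') j)"
      if Q: "Q \<in> ?I" "Q' \<in> ?I" "Q \<noteq> Q'" for Q Q'
    proof -
      have r: "rep Q \<in> \<T>" "rep Q' \<in> \<T>" "rep Q \<inter> S \<noteq> rep Q' \<inter> S"
        using rep Q by auto
      then obtain u where u: "u \<in> S" "u \<in> rep Q \<and> u \<notin> rep Q' \<or> u \<in> rep Q' \<and> u \<notin> rep Q"
        by blast
      then have "d / 2 \<le> \<bar>p u (A (rep Q)) - p u (A (rep Q'))\<bar>"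
        using ins[of "rep Q" u] out[of "rep Q'" u] ins[of "rep Q'" u] out[of "rep Q" u] r
        by (auto simp: pA abs_if)
      then show ?thesis
        using u(1) diff[of u "A (rep Q)" "A (rep Q')"] diff'[of u "A (rep Q')" "A (rep Q)"]
        by (intro bexI[of _ u]) linarith+
    qed
    show "real d / 2 \<le> 2 * (D * d)"
    proof -
      have "1 * real d \<le> D * d" using D by (intro mult_right_mono) auto
      then show ?thesis by simp
    qed
  qed (use d T A0 rep tri hom in auto)
  then show ?thesis using d by (simp add: card_cartesian_product mult.commute)
qed

text \<open>\<open>N\<close> is the number of almost orthogonal sign vectors. The first inequality
  is their abundance, the second the logarithm of \<open>shattering_count\<close> with
  \<open>M\<close> from \<open>patterns_card_le\<close>.\<close>

lemma universal_dimension_bound: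
  assumes U: "norm_on d' U" and d: "0 < d" and D: "1 \<le> D"
    and emb: "\<And>X. norm_on d X \<Longrightarrow> randomly_embeds d X d' U D"
  shows "\<exists>N::nat. exp (d / (16 * D\<^sup>2)) \<le> 2 * N
    \<and> 5 / 96 * N \<le> d' * d * ln (8 * 4 ^ (d' * d) * (2 * D))"
proof -
  \<comment> \<open>Chosen so that \<open>D * (\<gamma> * d) = d / 2\<close>: even after distortion
    \<open>D\<close>, points outside \<open>T\<close> stay at most half as long as the points of
    \<open>T\<close>.\<close>
  define \<gamma> where "\<gamma> = 1 / (2 * D)"
  have g: "0 < \<gamma>" "\<gamma> < 1" "D * \<gamma> = 1 / 2" using D by (auto simp: \<gamma>_def)
  obtain W where W: "finite W" "W \<subseteq> Rn d" and W1: "\<And>u i. u \<in> W \<Longrightarrow> i < d \<Longrightarrow> \<bar>u i\<bar> = 1"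
    and orth: "\<And>u v. u \<in> W \<Longrightarrow> v \<in> W \<Longrightarrow> u \<noteq> v \<Longrightarrow> \<bar>dot d u v\<bar> \<le> \<gamma> * d"
    and cardW: "exp (\<gamma>\<^sup>2 * d / 4) \<le> 2 * real (card W)"
    using almost_orthogonal_signs_exist[OF d, of \<gamma>] g by (metis less_imp_le)
  let ?X = "test_norm d \<gamma>"
  let ?good = "\<lambda>T f. {u \<in> W. ?X T u \<le> U (f u) \<and> U (f u) \<le> D * ?X T u}"
  have l1: "(\<Sum>i<d. \<bar>u i\<bar>) = d" if "u \<in> W" for u using W1 that by simp
  have self: "dot d u u = d" if "u \<in> W" for u
  proof -
    have "u i * u i = 1" if "i < d" for i
      using W1[OF \<open>u \<in> W\<close> that] by (metis abs_mult_self_eq mult_1)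
    then have "dot d u u = (\<Sum>i<d. 1)" unfolding dot_def by (intro sum.cong) auto
    then show ?thesis by simp
  qed
  have gd: "\<gamma> * d \<le> d" using g by (simp add: mult_left_le_one_le)
  have Xle: "?X T u \<le> d" if "u \<in> W" "T \<subseteq> W" for T u
  proof -
    have "\<bar>dot d u t\<bar> \<le> d" if "t \<in> T" for t
      using orth[of u t] self[of u] gd \<open>u \<in> W\<close> \<open>T \<subseteq> W\<close> that by (cases "u = t") force+
    then show ?thesis using that W gd by (simp add: test_norm_le_iff finite_subset l1)
  qed
  have Xin: "d \<le> ?X T u" if "u \<in> T" "T \<subseteq> W" for T u
    using test_norm_ge(2)[of T u d u \<gamma>] self[of u] that W by (auto simp: finite_subset)
  have Xout: "?X T u \<le> \<gamma> * d" if "u \<in> W" "T \<subseteq> W" "u \<notin> T" for T u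
  proof -
    have "\<bar>dot d u t\<bar> \<le> \<gamma> * d" if "t \<in> T" for t
      using orth[of u t] \<open>u \<in> W\<close> \<open>T \<subseteq> W\<close> \<open>u \<notin> T\<close> that by auto
    then show ?thesis using that W by (simp add: test_norm_le_iff finite_subset l1)
  qed
  have "\<forall>T\<in>Pow W. \<exists>f. f \<in> lin_maps d d' \<and> 2 * card W \<le> 3 * card (?good T f)"
  proof
    fix T assume "T \<in> Pow W"
    then have "finite T" using W(1) finite_subset by auto
    from randomly_embeds_good_map[OF emb[OF norm_on_test_norm[OF this g(1)]] W]
    show "\<exists>f. f \<in> lin_maps d d' \<and> 2 * card W \<le> 3 * card (?good T f)" by blast
  qed
  from bchoice[OF this] obtain F where F: "\<And>T. T \<subseteq> W \<Longrightarrow> F T \<in> lin_maps d d'"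
    and Fgood: "\<And>T. T \<subseteq> W \<Longrightarrow> 2 * card W \<le> 3 * card (?good T (F T))"
    by blast
  define G where "G T = ?good T (F T)" for T
  let ?M = "(8 * 4 ^ (d' * d) * (2 * D)) ^ (d' * d)"
  have "2 powr (5 / 3 * real (card W)) \<le> ?M * 3 ^ card W"
  proof (rule shattering_count[OF W(1), of G])
    fix S assume S: "S \<subseteq> W"
    show "real (card ((\<lambda>T. T \<inter> S) ` {T \<in> Pow W. S \<subseteq> G T})) \<le> ?M"
    proof (rule patterns_card_le[OF U d D, where F = F])
      show "S \<subseteq> Rn d" using S W by auto
      show "finite {T \<in> Pow W. S \<subseteq> G T}" using W by simp
      fix T assume T: "T \<in> {T \<in> Pow W. S \<subseteq> G T}"
      then show "F T \<in> lin_maps d d'" using F by auto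
      fix u assume u: "u \<in> S"
      have *: "u \<in> W" "T \<subseteq> W" "?X T u \<le> U (F T u)" "U (F T u) \<le> D * ?X T u"
        using T u S by (auto simp: G_def)
      show "U (F T u) \<le> D * d" using D by (intro order_trans[OF *(4)] mult_left_mono Xle *) simp
      show "d \<le> U (F T u)" if "u \<in> T" using Xin[OF that *(2)] *(3) by simp
      show "U (F T u) \<le> d / 2" if "u \<notin> T"
      proof -
        have "D * ?X T u \<le> D * (\<gamma> * d)" using Xout[OF *(1,2) that] D by (intro mult_left_mono) auto
        also have "\<dots> = (D * \<gamma>) * d" by simp
        also have "\<dots> = d / 2" unfolding g(3) by simp
        finally show ?thesis using *(4) by simp
      qed
    qed
  qed (use Fgood in \<open>auto simp: G_def\<close>)
  then have "ln (2 powr (5 / 3 * real (card W))) \<le> ln (?M * 3 ^ card W)" by (subst ln_le_cancel_iff) (use D in auto)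
  also have "\<dots> = d' * d * ln (8 * 4 ^ (d' * d) * (2 * D)) + card W * ln 3"
    using D by (simp add: ln_mult_pos ln_realpow algebra_simps)
  finally have "card W * (5 / 3 * ln 2 - ln 3) \<le> d' * d * ln (8 * 4 ^ (d' * d) * (2 * D))"
    by (simp add: ln_powr algebra_simps)
  \<comment> \<open>A quantitative form of \<open>32 > 27\<close>: the right-hand side is a third of
    \<open>- ln (27 / 32)\<close>, which is at least \<open>5 / 32\<close>.\<close>
  moreover have "5 / 96 \<le> 5 / 3 * ln 2 - ln (3::real)"
  proof -
    have "ln (27 / 32) \<le> 27 / 32 - (1::real)" by (rule ln_le_minus_one) simp
    moreover have "ln (27 / 32::real) = 3 * ln 3 - 5 * ln 2"
      using ln_div[of "3 ^ 3::real" "2 ^ 5"] ln_realpow[of "3::real" 3] ln_realpow[of "2::real" 5] by simp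
    ultimately show ?thesis by simp
  qed
  then have "5 / 96 * real (card W) \<le> card W * (5 / 3 * ln 2 - ln 3)"
    using mult_left_mono[of "5 / 96" "5 / 3 * ln 2 - ln (3::real)" "card W"] by simp
  ultimately have "5 / 96 * real (card W) \<le> d' * d * ln (8 * 4 ^ (d' * d) * (2 * D))" by linarith
  moreover have "\<gamma>\<^sup>2 * d / 4 = d / (16 * D\<^sup>2)" by (simp add: \<gamma>_def power2_eq_square)
  ultimately show ?thesis using cardW by (intro exI[of _ "card W"]) simp
qed

text \<open>With \<open>D \<le> d\<close> the logarithm is at most linear in \<open>d' * d\<close>,
  so \<open>exp (d / (16 * D\<^sup>2))\<close> is at most quadratic in it; taking square roots
  halves the exponent.\<close>

lemma universal_dimension_explicit:
  assumes U: "norm_on d' U" and d: "0 < d" and D: "D \<le> d"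
    and emb: "\<And>X. norm_on d X \<Longrightarrow> randomly_embeds d X d' U D"
  shows "1 \<le> D" "exp (d / (32 * D\<^sup>2)) \<le> 22 * real d * real d'"
proof -
  show D1: "1 \<le> D"
  proof -
    \<comment> \<open>One unit vector suffices: some map \<open>f\<close> is good at
      \<open>?e\<close>, which gives \<open>1 \<le> U (f ?e)\<close> and
      \<open>U (f ?e) \<le> D\<close>.\<close>
    let ?e = "\<lambda>i::nat. if i = 0 then 1 else 0 :: real"
    let ?X = "test_norm d 1 {}"
    have X: "?X ?e = 1" using d by (simp add: test_norm_def)
    have e: "?e \<in> Rn d" using d by (simp add: topspace_Euclidean_space)
    have "randomly_embeds d ?X d' U D" "finite {?e}" "{?e} \<subseteq> Rn d"
      using e by (auto intro!: emb norm_on_test_norm)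
    from randomly_embeds_good_map[OF this] obtain f where
      "2 * card {?e} \<le> 3 * card {u \<in> {?e}. ?X u \<le> U (f u) \<and> U (f u) \<le> D * ?X u}"
      by blast
    then have "{u \<in> {?e}. ?X u \<le> U (f u) \<and> U (f u) \<le> D * ?X u} \<noteq> {}"
      by (metis (no_types, lifting) card.empty card_1_singleton_iff mult_0_right not_numeral_le_zero One_nat_def nat_mult_1_right)
    then show ?thesis using X by auto
  qed
  obtain N :: nat where N: "exp (d / (16 * D\<^sup>2)) \<le> 2 * N"
    "5 / 96 * N \<le> d' * d * ln (8 * 4 ^ (d' * d) * (2 * D))"
    using universal_dimension_bound[OF U d D1] emb by auto
  define n where "n = d' * d"
  have "0 < exp (d / (16 * D\<^sup>2))" by simp
  then have "N > 0" using N(1) by (intro gr0I) simp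
  \<comment> \<open>For \<open>d' = 0\<close> the second bound would force
    \<open>N = 0\<close>.\<close>
  then have "d' \<noteq> 0" using N(2) by (intro notI) simp
  then have "1 \<le> n" "d \<le> n" using d by (auto simp: n_def Suc_le_eq)
  then have n: "1 \<le> real n" "real d \<le> n" by auto
  have "ln (8 * 4 ^ n * (2 * D)) = ln 8 + n * ln 4 + ln (2 * D)"
    using D1 ln_mult_pos[of "8::real" 2] by (simp add: ln_mult_pos ln_realpow)
  also have "\<dots> \<le> 7 + real n * 3 + (2 * D - 1)"
  proof -
    have "ln 8 \<le> (7::real)" using ln_le_minus_one[of "8::real"] by simp
    moreover have "real n * ln 4 \<le> real n * 3"
      using ln_le_minus_one[of "4::real"] by (intro mult_left_mono) auto
    moreover have "ln (2 * D) \<le> 2 * D - 1" using D1 by (intro ln_le_minus_one) simp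
    ultimately show ?thesis by simp
  qed
  also have "\<dots> \<le> 12 * n" using n D by linarith
  finally have "real n * ln (8 * 4 ^ n * (2 * D)) \<le> real n * real (12 * n)" by (intro mult_left_mono) auto
  \<comment> \<open>Here \<open>2 * N \<le> 2 * (96 / 5) * 12 * n\<^sup>2\<close>, and the constant
    460.8 is rounded up to the square \<open>484 = 22\<^sup>2\<close>.\<close>
  then have "exp (d / (16 * D\<^sup>2)) \<le> 484 * (real n)\<^sup>2"
    using N unfolding n_def[symmetric] of_nat_mult[symmetric] by (simp add: power2_eq_square)
  moreover have "exp (d / (16 * D\<^sup>2)) = (exp (d / (32 * D\<^sup>2)))\<^sup>2"
    by (simp flip: exp_double)
  ultimately have "(exp (d / (32 * D\<^sup>2)))\<^sup>2 \<le> (22 * real n)\<^sup>2" by (simp add: power_mult_distrib)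
  then have "exp (d / (32 * D\<^sup>2)) \<le> 22 * real n" by (rule power2_le_imp_le) simp
  then show "exp (d / (32 * D\<^sup>2)) \<le> 22 * real d * real d'" by (simp add: n_def mult_ac)
qed

section \<open>Asymptotic form\<close>

theorem theorem6p1:
  fixes \<epsilon> :: real and D :: "nat \<Rightarrow> real"
  assumes "\<epsilon> > 0"
    and "D \<in> O(\<lambda>d. real d powr (1 / 2 - \<epsilon>))"
  shows "\<exists>c>0. \<forall>\<^sub>F d in sequentially.
           \<forall>d' U. norm_on d' U \<longrightarrow> (\<forall>X. norm_on d X \<longrightarrow> randomly_embeds d X d' U (D d)) \<longrightarrow>
             real d' \<ge> exp (c * real d powr (2 * \<epsilon>))"
proof -
  obtain K where K: "K > 0" and DK: "\<forall>\<^sub>F d in sequentially. norm (D d) \<le> K * norm (real d powr (1 / 2 - \<epsilon>))"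
    using assms(2) by (rule landau_o.bigE)
  \<comment> \<open>The growth bound on \<open>D\<close> makes
    \<open>d / (32 * (D d)\<^sup>2)\<close> at least
    \<open>2 * (c * real d powr (2 * \<epsilon>))\<close>; one half of this exponent absorbs the
    factor \<open>22 * real d\<close>, the other half remains.\<close>
  define c where "c = 1 / (64 * K\<^sup>2)"
  have c: "c > 0" using K by (simp add: c_def)
  have "\<forall>\<^sub>F d in sequentially. K * real d powr (1 / 2 - \<epsilon>) \<le> d"
    using assms(1) K by real_asymp
  moreover have "\<forall>\<^sub>F d in sequentially. 22 * real d \<le> exp (c * real d powr (2 * \<epsilon>))"
    using assms(1) c by real_asymp
  ultimately have "\<forall>\<^sub>F d in sequentially.
           \<forall>d' U. norm_on d' U \<longrightarrow> (\<forall>X. norm_on d X \<longrightarrow> randomly_embeds d X d' U (D d)) \<longrightarrow>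
             real d' \<ge> exp (c * real d powr (2 * \<epsilon>))"
    using DK eventually_gt_at_top[of 0]
  proof (eventually_elim, intro allI impI)
    fix d d' U
    assume big: "K * real d powr (1 / 2 - \<epsilon>) \<le> d" "22 * real d \<le> exp (c * real d powr (2 * \<epsilon>))"
      and "norm (D d) \<le> K * norm (real d powr (1 / 2 - \<epsilon>))" and d: "0 < d"
      and U: "norm_on d' U" and emb: "\<forall>X. norm_on d X \<longrightarrow> randomly_embeds d X d' U (D d)"
    then have DK': "D d \<le> K * real d powr (1 / 2 - \<epsilon>)" by simp
    have D1: "1 \<le> D d" and ex: "exp (d / (32 * (D d)\<^sup>2)) \<le> 22 * real d * real d'"
      using universal_dimension_explicit[OF U d, of "D d"] DK' big(1) emb by auto
    have "(D d)\<^sup>2 \<le> (K * real d powr (1 / 2 - \<epsilon>))\<^sup>2" using DK' D1 by (intro power_mono) auto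
    also have "\<dots> = K\<^sup>2 * real d powr (1 - 2 * \<epsilon>)"
      by (simp add: power_mult_distrib power2_eq_square powr_add[symmetric])
    finally have "real d powr (2 * \<epsilon>) * (D d)\<^sup>2
        \<le> real d powr (2 * \<epsilon>) * (K\<^sup>2 * real d powr (1 - 2 * \<epsilon>))"
      by (intro mult_left_mono) auto
    also have "\<dots> = K\<^sup>2 * (real d powr (2 * \<epsilon>) * real d powr (1 - 2 * \<epsilon>))" by simp
    also have "\<dots> = K\<^sup>2 * d" using d by (simp flip: powr_add)
    finally have "2 * (c * real d powr (2 * \<epsilon>)) \<le> d / (32 * (D d)\<^sup>2)"
      using K D1 by (simp add: c_def field_simps)
    then have "exp (2 * (c * real d powr (2 * \<epsilon>))) \<le> 22 * real d * real d'"
      using ex by (meson exp_le_cancel_iff order_trans)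
    also have "\<dots> \<le> exp (c * real d powr (2 * \<epsilon>)) * d'"
      using big(2) by (intro mult_right_mono) auto
    finally show "exp (c * real d powr (2 * \<epsilon>)) \<le> d'"
      by (simp add: exp_double power2_eq_square)
  qed
  then show ?thesis using c by blast
qed

end
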